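(* Let $N$ be a CP-net with variables $X_1,\ldots,X_n$ and finite non-empty domains $\mathcal{D}(X_1),\ldots,\mathcal{D}(X_n)$, and let $\mathcal{G}(N)$ be the associated strategic game with parametrized preferences. Then an outcome $s \in \mathcal{D}(X_1)\times\cdots\times\mathcal{D}(X_n)$ of $N$ is optimal in $N$ if and only if $s$ is a Nash equilibrium of $\mathcal{G}(N)$.
   Context: A preference on a set $A$ is a strict linear ordering on $A$; $\succeq$ denotes the corresponding weak preference ($a \succeq b$ iff $a \succ b$ or $a=b$). **CP-nets.** A CP-net consists of variables $X_1,\ldots,X_n$ with finite non-empty domains $\mathcal{D}(X_i)$; for each $i$ a (possibly empty) set of parents $Pa(X_i) = \{X_{i_1},\ldots,X_{i_k}\} \subseteq \{X_1,\ldots,X_n\}\setminus\{X_i\}$, with index sequence $I = i_1,\ldots,i_k$ (a subsequence of $1,\ldots,i-1,i+1,\ldots,n$); and for each $i$ and each complete assignment $a_I \in \mathcal{D}(X_I) := \mathcal{D}(X_{i_1})\times\cdots\times\mathcal{D}(X_{i_k})$ exactly one preference statement $X_I = a_I : \succ(a_I)$, where $\succ(a_I)$ is a preference on $\mathcal{D}(X_i)$. The dependency graph may contain cycles. An outcome is an element $s=(s_1,\ldots,s_n)$ of $\mathcal{D}(X_1)\times\cdots\times\mathcal{D}(X_n)$. A worsening flip is a transition from an outcome $\alpha$ to an outcome $\beta$ that differ in the value of a single variable $X_i$, where $\alpha_i$ is preferred to $\beta_i$ in the unique preference statement for $X_i$ determined by the (common) values of $\alpha,\beta$ on $Pa(X_i)$.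 An outcome $\alpha$ is better than $\beta$, written $\alpha\succ\beta$, iff there is a chain of (one or more) worsening flips from $\alpha$ to $\beta$. An outcome is optimal if no better outcome exists. **Games.** A strategic game with parametrized preferences for $n$ players consists of a finite non-empty set $S_i$ of strategies for each player $i$ and, for each $i$ and each $s_{-i}\in S_{-i} := \prod_{j\ne i} S_j$, a preference $\succ(s_{-i})$ on $S_i$. A joint strategy $s\in S_1\times\cdots\times S_n$ is a (pure) Nash equilibrium if for all $i$ and all $s_i'\in S_i$, $s_i \succeq(s_{-i})\ s_i'$, where $s_{-i}$ is $s$ with its $i$th component removed. **The game $\mathcal{G}(N)$.** Given a CP-net $N$, $\mathcal{G}(N)$ has one player $i$ for each variable $X_i$, with strategy set $S_i = \mathcal{D}(X_i)$. For a joint strategy $a_{-i}$ of the opponents of player $i$, the preference of player $i$ is $\succ(a_{-i}) := \succ(a_I)$, where $I$ is the index sequence of $Pa(X_i)$, $a_I$ is the projection of $a_{-i}$ onto $I$, and $X_I = a_I:\succ(a_I)$ is the unique preference statement of $N$ for $X_i$ determined by $a_I$. *)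

theory Defs
  imports Main "HOL-Library.FuncSet"
begin

text \<open>
  A pair \<open>(a, b)\<close> in a preference relation means that \<open>a\<close> is strictly preferred to \<open>b\<close>; the weak
  preference is then the reflexive closure of the relation.
\<close>

definition preference_on :: "'a set \<Rightarrow> 'a rel \<Rightarrow> bool" where
  "preference_on A r \<longleftrightarrow> r \<subseteq> A \<times> A \<and> strict_linear_order_on A r"

text \<open>
  The variables are the indices \<open>1, \<dots>, n\<close>, and all domains are sets over one value type, which
  loses no generality for finitely many domains. An assignment to a set \<open>I\<close> of variables is an
  extensional function on \<open>I\<close>, so that projection onto \<open>I\<close> is \<open>restrict\<close>; this replaces the tuples
  indexed by the increasing enumeration of \<open>I\<close>. Having exactly one preference statement for each
  variable and each assignment to its parents is expressed by \<open>cp_pref\<close> being a function; its values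
  at other arguments are irrelevant.
\<close>

record 'a cp_net =
  cp_size :: nat
  cp_dom :: "nat \<Rightarrow> 'a set"
  cp_parents :: "nat \<Rightarrow> nat set"
  cp_pref :: "nat \<Rightarrow> (nat \<Rightarrow> 'a) \<Rightarrow> 'a rel"

definition is_cp_net :: "'a cp_net \<Rightarrow> bool" where
  "is_cp_net N \<longleftrightarrow>
    (\<forall>i\<in>{1..cp_size N}.
      finite (cp_dom N i) \<and> cp_dom N i \<noteq> {} \<and>
      cp_parents N i \<subseteq> {1..cp_size N} - {i} \<and>
      (\<forall>a \<in> Pi\<^sub>E (cp_parents N i) (cp_dom N). preference_on (cp_dom N i) (cp_pref N i a)))"

definition outcomes :: "'a cp_net \<Rightarrow> (nat \<Rightarrow> 'a) set" where
  "outcomes N = Pi\<^sub>E {1..cp_size N} (cp_dom N)"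

definition worsening_flip :: "'a cp_net \<Rightarrow> (nat \<Rightarrow> 'a) rel" where
  "worsening_flip N =
    {(\<alpha>, \<beta>). \<alpha> \<in> outcomes N \<and> \<beta> \<in> outcomes N \<and>
      (\<exists>i\<in>{1..cp_size N}.
        \<alpha> i \<noteq> \<beta> i \<and> (\<forall>j\<in>{1..cp_size N} - {i}. \<alpha> j = \<beta> j) \<and>
        (\<alpha> i, \<beta> i) \<in> cp_pref N i (restrict \<alpha> (cp_parents N i)))}"

definition better :: "'a cp_net \<Rightarrow> (nat \<Rightarrow> 'a) \<Rightarrow> (nat \<Rightarrow> 'a) \<Rightarrow> bool" where
  "better N \<alpha> \<beta> \<longleftrightarrow> (\<alpha>, \<beta>) \<in> (worsening_flip N)\<^sup>+"

definition optimal :: "'a cp_net \<Rightarrow> (nat \<Rightarrow> 'a) \<Rightarrow> bool" where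
  "optimal N s \<longleftrightarrow> s \<in> outcomes N \<and> \<not> (\<exists>t \<in> outcomes N. better N t s)"

record 'a param_game =
  players :: nat
  strategies :: "nat \<Rightarrow> 'a set"
  game_pref :: "nat \<Rightarrow> (nat \<Rightarrow> 'a) \<Rightarrow> 'a rel"

definition opponents :: "'a param_game \<Rightarrow> nat \<Rightarrow> nat set" where
  "opponents G i = {1..players G} - {i}"

definition is_param_game :: "'a param_game \<Rightarrow> bool" where
  "is_param_game G \<longleftrightarrow>
    (\<forall>i\<in>{1..players G}.
      finite (strategies G i) \<and> strategies G i \<noteq> {} \<and>
      (\<forall>a \<in> Pi\<^sub>E (opponents G i) (strategies G). preference_on (strategies G i) (game_pref G i a)))"

definition joint_strategies :: "'a param_game \<Rightarrow> (nat \<Rightarrow> 'a) set" where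
  "joint_strategies G = Pi\<^sub>E {1..players G} (strategies G)"

definition nash_equilibrium :: "'a param_game \<Rightarrow> (nat \<Rightarrow> 'a) \<Rightarrow> bool" where
  "nash_equilibrium G s \<longleftrightarrow>
    s \<in> joint_strategies G \<and>
    (\<forall>i\<in>{1..players G}. \<forall>t\<in>strategies G i.
      (s i, t) \<in> (game_pref G i (restrict s (opponents G i)))\<^sup>=)"

definition game_of :: "'a cp_net \<Rightarrow> 'a param_game" where
  "game_of N =
    \<lparr>players = cp_size N,
     strategies = cp_dom N,
     game_pref = (\<lambda>i a. cp_pref N i (restrict a (cp_parents N i)))\<rparr>"

lemma is_param_game_game_of:
  assumes "is_cp_net N"
  shows "is_param_game (game_of N)"
  unfolding is_param_game_def
proof (intro ballI conjI)
  fix i assume "i \<in> {1..players (game_of N)}"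
  then have i: "i \<in> {1..cp_size N}"
    by (simp add: game_of_def)
  show "finite (strategies (game_of N) i)" "strategies (game_of N) i \<noteq> {}"
    using assms i unfolding is_cp_net_def game_of_def by auto
  fix a assume a: "a \<in> Pi\<^sub>E (opponents (game_of N) i) (strategies (game_of N))"
  have "cp_parents N i \<subseteq> {1..cp_size N} - {i}"
    using assms i unfolding is_cp_net_def by blast
  then have "restrict a (cp_parents N i) \<in> Pi\<^sub>E (cp_parents N i) (cp_dom N)"
    using a by (auto simp: game_of_def opponents_def PiE_iff subset_iff)
  then show "preference_on (strategies (game_of N) i) (game_pref (game_of N) i a)"
    using assms i unfolding is_cp_net_def by (simp add: game_of_def)
qed

end

theory Submission
  imports Defs
begin

text \<open>
  An outcome has a better one iff some worsening flip leads into it, namely the last flip of a chain.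
  A flip into \<open>s\<close> at \<open>i\<close> starts from \<open>s(i := x)\<close> and exists iff \<open>x\<close> is preferred to \<open>s i\<close> given
  the parents of \<open>i\<close>, that is, iff player \<open>i\<close> can profitably deviate to \<open>x\<close>.
\<close>

lemma optimal_iff_no_flip:
  assumes "s \<in> outcomes N"
  shows "optimal N s \<longleftrightarrow> (\<forall>t. (t, s) \<notin> worsening_flip N)"
proof -
  have "t \<in> outcomes N \<and> better N t s" if "(t, s) \<in> worsening_flip N" for t
    using that by (auto simp: better_def worsening_flip_def)
  then show ?thesis
    using assms unfolding optimal_def better_def by (blast dest: tranclD2)
qed

text \<open>Since \<open>i\<close> is not among its own parents, a flip at \<open>i\<close> leaves
  the values of the parents unchanged, so the preference statement that the flip uses at its source
  can be read off at its target \<open>s\<close>.\<close>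

lemma flip_into_iff:
  assumes "is_cp_net N" and "s \<in> outcomes N"
  shows "(\<exists>t. (t, s) \<in> worsening_flip N) \<longleftrightarrow>
    (\<exists>i\<in>{1..cp_size N}. \<exists>x\<in>cp_dom N i.
      x \<noteq> s i \<and> (x, s i) \<in> cp_pref N i (restrict s (cp_parents N i)))"
    (is "?L \<longleftrightarrow> ?R")
proof
  assume ?L
  then obtain t i where t: "t \<in> outcomes N" and i: "i \<in> {1..cp_size N}" and "t i \<noteq> s i"
    and eq: "\<forall>j\<in>{1..cp_size N} - {i}. t j = s j"
    and pref: "(t i, s i) \<in> cp_pref N i (restrict t (cp_parents N i))"
    unfolding worsening_flip_def by blast
  have "cp_parents N i \<subseteq> {1..cp_size N} - {i}"
    using assms(1) i unfolding is_cp_net_def by blast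
  then have "restrict t (cp_parents N i) = restrict s (cp_parents N i)"
    using eq by (intro restrict_ext) blast
  \<comment> \<open>The witness for \<open>x\<close> is \<open>t i\<close>, the value that the flip
    replaces.\<close>
  moreover have "t i \<in> cp_dom N i"
    using t i unfolding outcomes_def by blast
  ultimately show ?R
    using i \<open>t i \<noteq> s i\<close> pref by metis
next
  assume ?R
  then obtain i x where i: "i \<in> {1..cp_size N}" and x: "x \<in> cp_dom N i" "x \<noteq> s i"
    and pref: "(x, s i) \<in> cp_pref N i (restrict s (cp_parents N i))"
    by blast
  have "i \<notin> cp_parents N i"
    using assms(1) i unfolding is_cp_net_def by blast
  then have "restrict (s(i := x)) (cp_parents N i) = restrict s (cp_parents N i)"
    by (intro restrict_ext) auto
  \<comment> \<open>The update stays extensional because \<open>i\<close> lies in the index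
    set.\<close>
  moreover have "s(i := x) \<in> outcomes N"
    using assms(2) i x(1) by (auto simp: outcomes_def PiE_iff extensional_def)
  ultimately have "(s(i := x), s) \<in> worsening_flip N"
    using assms(2) i x(2) pref unfolding worsening_flip_def by auto
  then show ?L by blast
qed

text \<open>From left to right this is asymmetry, which follows from irreflexivity and transitivity;
  from right to left it is totality.\<close>

lemma preference_on_weak_iff:
  assumes "preference_on A r" and "a \<in> A" and "b \<in> A"
  shows "(a, b) \<in> r\<^sup>= \<longleftrightarrow> \<not> (b \<noteq> a \<and> (b, a) \<in> r)"
  using assms unfolding preference_on_def strict_linear_order_on_def total_on_def irrefl_def trans_def
  by blast

text \<open>By linearity of the preferences, \<open>s i\<close> is weakly best iff no other strategy
  is strictly preferred to it. This form is the exact negation of the right-hand side of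
  \<open>flip_into_iff\<close>.\<close>

lemma nash_equilibrium_game_of_iff:
  assumes "is_cp_net N" and "s \<in> outcomes N"
  shows "nash_equilibrium (game_of N) s \<longleftrightarrow>
    (\<forall>i\<in>{1..cp_size N}. \<forall>x\<in>cp_dom N i.
      \<not> (x \<noteq> s i \<and> (x, s i) \<in> cp_pref N i (restrict s (cp_parents N i))))"
proof -
  have weak: "(s i, x) \<in> (game_pref (game_of N) i (restrict s (opponents (game_of N) i)))\<^sup>= \<longleftrightarrow>
      \<not> (x \<noteq> s i \<and> (x, s i) \<in> cp_pref N i (restrict s (cp_parents N i)))"
    if i: "i \<in> {1..cp_size N}" and x: "x \<in> cp_dom N i" for i x
  proof -
    have parents: "cp_parents N i \<subseteq> {1..cp_size N} - {i}"
      using assms(1) i unfolding is_cp_net_def by blast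
    \<comment> \<open>\<open>is_cp_net\<close> guarantees a preference only at assignments to the
      parents.\<close>
    then have "restrict s (cp_parents N i) \<in> Pi\<^sub>E (cp_parents N i) (cp_dom N)"
      using assms(2) by (auto simp: outcomes_def PiE_iff subset_iff)
    then have "preference_on (cp_dom N i) (cp_pref N i (restrict s (cp_parents N i)))"
      using assms(1) i unfolding is_cp_net_def by blast
    moreover have "s i \<in> cp_dom N i"
      using assms(2) i unfolding outcomes_def by blast
    \<comment> \<open>All parents are opponents, so projecting first onto the opponents and then
      onto the parents is the same as projecting onto the parents directly.\<close>
    moreover have "game_pref (game_of N) i (restrict s (opponents (game_of N) i)) =
        cp_pref N i (restrict s (cp_parents N i))"
      using parents by (simp add: game_of_def opponents_def Int_absorb1)
    ultimately show ?thesis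
      using preference_on_weak_iff x by metis
  qed
  have "s \<in> joint_strategies (game_of N)"
    using assms(2) by (simp add: joint_strategies_def outcomes_def game_of_def)
  moreover have "players (game_of N) = cp_size N" "strategies (game_of N) = cp_dom N"
    by (simp_all add: game_of_def)
  ultimately show ?thesis
    unfolding nash_equilibrium_def using weak by simp
qed

theorem theorem1:
  fixes N :: "'a cp_net" and s :: "nat \<Rightarrow> 'a"
  assumes "is_cp_net N" and "s \<in> outcomes N"
  shows "optimal N s \<longleftrightarrow> nash_equilibrium (game_of N) s"
  using optimal_iff_no_flip[OF assms(2)] flip_into_iff[OF assms]
    nash_equilibrium_game_of_iff[OF assms]
  by blast

end
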